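(* Let $n\geq3$, let $Q$ be a set of clausal relations on $D=\{0,\dots,n-1\}$, and put $F:=\mathrm{Pol}(Q)$. Suppose that \begin{itemize} \item for each $0\leq b<n-1$ there is some $f\in F$ that does not preserve $\theta_b$, where $\theta_b$ is the equivalence relation on $D$ belonging to the non-trivial partition $D/\theta_b=\{\{0,\dots,b\},\{b+1,\dots,n-1\}\}$; \item for each $a,b$ with $0<a\leq b<n-1$ there is some $f\in F$ that does not preserve $\{0,\dots,b\}^2\cup\{a,\dots,n-1\}^2$; and \item for each $0\leq b\leq n-3$ and all $2\leq k\leq n-1-b$ there is some $f\in F$ that does not preserve the unary relation $\{0,\dots,b\}\cup\{b+k,\dots,n-1\}$. \end{itemize} Then $F=\mathrm{Pol}(Q)=\mathrm{O}_D$.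
   Context: Let $D=\{0,1,\dots,n-1\}$ with its canonical linear order $\leq$. For $k\geq1$, $\mathrm{O}_D^{(k)}$ is the set of all functions $D^k\to D$, and $\mathrm{O}_D=\bigcup_{k\geq1}\mathrm{O}_D^{(k)}$. An operation $f\in\mathrm{O}_D^{(k)}$ preserves a relation $\varrho\subseteq D^m$ ($m\ge 1$) if for all $r_1,\dots,r_k\in\varrho$ the tuple obtained by applying $f$ componentwise to $r_1,\dots,r_k$ lies in $\varrho$. For a set $Q$ of finitary relations on $D$, $\mathrm{Pol}(Q)$ is the set of all $f\in\mathrm{O}_D$ preserving every member of $Q$. For $p,q\geq1$, $\mathbf a\in D^p$, $\mathbf b\in D^q$, the clausal relation $R^{\mathbf a}_{\mathbf b}$ is the set of all $(x_1,\dots,x_p,y_1,\dots,y_q)\in D^{p+q}$ satisfying $(x_1\geq a_1)\vee\dots\vee(x_p\geq a_p)\vee(y_1\leq b_1)\vee\dots\vee(y_q\leq b_q)$. A clausal relation on $D$ is any relation of this form. *)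

theory Defs
  imports Main "HOL-Library.FuncSet"
begin

(* The power D^k, with k-tuples encoded as lists of length k. *)
definition tuples :: "'a set \<Rightarrow> nat \<Rightarrow> 'a list set" where
  "tuples D k = {xs. length xs = k \<and> set xs \<subseteq> D}"

(* A k-ary operation is tagged with its arity k, since an extensional function does not
   always determine its domain: if the value undefined happens to lie in D, then the
   constant operations of different arities with that value coincide as functions. *)
definition operations :: "'a set \<Rightarrow> (nat \<times> ('a list \<Rightarrow> 'a)) set" where
  "operations D = (SIGMA k:{1..}. tuples D k \<rightarrow>\<^sub>E D)"

(* Here rs lists the tuples r_1, ..., r_k, all of one length m; the j-th entry of
   transpose rs is the k-tuple of their j-th components. *)
fun preserves :: "nat \<times> ('a list \<Rightarrow> 'a) \<Rightarrow> 'a list set \<Rightarrow> bool" where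
  "preserves (k, f) \<rho> \<longleftrightarrow>
     (\<forall>rs. length rs = k \<and> set rs \<subseteq> \<rho> \<longrightarrow> map f (transpose rs) \<in> \<rho>)"

definition Pol :: "'a set \<Rightarrow> 'a list set set \<Rightarrow> (nat \<times> ('a list \<Rightarrow> 'a)) set" where
  "Pol D Q = {g \<in> operations D. \<forall>\<rho>\<in>Q. preserves g \<rho>}"

definition clausal_relation :: "'a::linorder set \<Rightarrow> 'a list \<Rightarrow> 'a list \<Rightarrow> 'a list set" where
  "clausal_relation D a b =
     {x @ y | x y. x \<in> tuples D (length a) \<and> y \<in> tuples D (length b) \<and>
        ((\<exists>i<length a. x ! i \<ge> a ! i) \<or> (\<exists>j<length b. y ! j \<le> b ! j))}"

definition clausal_relations :: "'a::linorder set \<Rightarrow> 'a list set set" where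
  "clausal_relations D =
     {clausal_relation D a b | a b p q.
        p \<ge> 1 \<and> q \<ge> 1 \<and> a \<in> tuples D p \<and> b \<in> tuples D q}"

(* The equivalence relation belonging to a partition P: the pairs inside a common block. *)
definition partition_relation :: "'a set set \<Rightarrow> 'a list set" where
  "partition_relation P = (\<Union>B\<in>P. tuples B 2)"

definition theta :: "nat \<Rightarrow> nat \<Rightarrow> nat list set" where
  "theta n b = partition_relation {{0..b}, {b + 1..n - 1}}"

end

theory Submission
  imports Defs
begin

text \<open>
  The clausal relation \<open>R\<^sup>a\<^sub>b\<close> is all of \<open>D\<^sup>p\<^sup>+\<^sup>q\<close> as soon as some \<open>a\<^sub>i = 0\<close> or some
  \<open>b\<^sub>j = n - 1\<close>, and then every operation preserves it. So it suffices to show that \<open>Q\<close> contains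
  no other relation. Suppose it does. Equating all the \<open>x\<close>-variables with each other, and likewise
  all the \<open>y\<close>-variables, turns \<open>R\<^sup>a\<^sub>b\<close> into the binary clause \<open>x \<ge> \<alpha> \<or> y \<le> \<beta>\<close> with
  \<open>\<alpha> = min a > 0\<close> and \<open>\<beta> = max b < n - 1\<close>. Equating variables and intersecting are primitive
  positive constructions, so the whole clone \<open>F\<close> preserves this clause and what can be
  built from it:

  \<^item> If \<open>\<alpha> \<le> \<beta> + 1\<close>, the clause intersected with its converse is
    \<open>{0..\<beta>}\<^sup>2 \<union> {\<alpha>..n - 1}\<^sup>2\<close>, for the following reason. A pair in neither
    square has a coordinate above \<open>\<beta>\<close> and a coordinate below \<open>\<alpha>\<close>. These are different
    coordinates because the two intervals cover \<open>D\<close>, so the pair violates the clause or its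
    converse; and both clauses clearly hold on both squares.
    For \<open>\<alpha> = \<beta> + 1\<close> this is the equivalence relation \<open>\<theta>\<^sub>\<beta>\<close>, and for \<open>\<alpha> \<le> \<beta>\<close> it is
    one of the relations with overlapping blocks.

  \<^item> If \<open>\<alpha> \<ge> \<beta> + 2\<close>, equating \<open>x\<close> and \<open>y\<close> leaves the unary relation
    \<open>{0..\<beta>} \<union> {\<alpha>..n - 1}\<close>.

  In each case \<open>F\<close> preserves a relation that by assumption some member of \<open>F\<close> violates.
\<close>

section \<open>Closure properties of preservation\<close>

lemma map_transpose_uniform:
  assumes "\<And>r. r \<in> set rs \<Longrightarrow> length r = m" and "rs \<noteq> []"
  shows "map f (transpose rs) = map (\<lambda>i. f (map (\<lambda>r. r ! i) rs)) [0..<m]"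
proof -
  have "transpose rs = map (\<lambda>i. map (\<lambda>j. rs ! j ! i) [0..<length rs]) [0..<m]"
    using assms by (intro transpose_rectangle) auto
  moreover have "map (\<lambda>j. rs ! j ! i) [0..<length rs] = map (\<lambda>r. r ! i) rs" for i
    by (rule nth_equalityI) auto
  ultimately show ?thesis
    by simp
qed

lemma preserves_Int:
  assumes "preserves g \<rho>" and "preserves g \<sigma>"
  shows "preserves g (\<rho> \<inter> \<sigma>)"
  using assms by (cases g) auto

lemma operations_preserve_tuples:
  assumes "g \<in> operations D"
  shows "preserves g (tuples D m)"
proof -
  obtain k f where g: "g = (k, f)"
    by (cases g)
  have k: "k \<ge> 1" and f: "f \<in> tuples D k \<rightarrow> D"
    using assms by (auto simp: g operations_def)
  have "map f (transpose rs) \<in> tuples D m"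
    if rs: "length rs = k" "set rs \<subseteq> tuples D m" for rs
  proof -
    have len: "length r = m" if "r \<in> set rs" for r
      using rs that by (auto simp: tuples_def)
    have "map (\<lambda>r. r ! i) rs \<in> tuples D k" if "i < m" for i
      using rs that by (fastforce simp: tuples_def)
    hence "f (map (\<lambda>r. r ! i) rs) \<in> D" if "i < m" for i
      using f that by auto
    moreover have "rs \<noteq> []"
      using rs k by auto
    ultimately show ?thesis
      using map_transpose_uniform[of rs m f] len by (auto simp: tuples_def)
  qed
  thus ?thesis
    by (auto simp: g)
qed

text \<open>
  The coordinate map \<open>h\<close> substitutes the variable \<open>h i\<close> for the \<open>i\<close>-th variable of \<open>\<rho>\<close>, so this
  covers identifying and permuting variables at once. It holds because operations act on
  tuples coordinate by coordinate and therefore commute with any such substitution.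
\<close>

lemma preserves_minor:
  assumes g: "g \<in> operations D" and \<rho>: "preserves g \<rho>"
    and h: "\<And>i. i < l \<Longrightarrow> h i < m"
  shows "preserves g {z \<in> tuples D m. map (\<lambda>i. z ! h i) [0..<l] \<in> \<rho>}" (is "preserves g ?\<sigma>")
proof -
  obtain k f where kf: "g = (k, f)"
    by (cases g)
  have k: "k \<ge> 1"
    using g by (auto simp: kf operations_def)
  have "map f (transpose rs) \<in> ?\<sigma>" if rs: "length rs = k" "set rs \<subseteq> ?\<sigma>" for rs
  proof -
    define rs' where "rs' = map (\<lambda>z. map (\<lambda>i. z ! h i) [0..<l]) rs"
    have ne: "rs \<noteq> []" "rs' \<noteq> []"
      using rs k by (auto simp: rs'_def)
    have len: "length r = m" if "r \<in> set rs" for r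
      using rs that by (auto simp: tuples_def)
    have len': "length r = l" if "r \<in> set rs'" for r
      using that by (auto simp: rs'_def)
    have "preserves g (tuples D m)"
      using g by (rule operations_preserve_tuples)
    hence tup: "map f (transpose rs) \<in> tuples D m"
      using rs by (auto simp: kf)
    have "length rs' = k" "set rs' \<subseteq> \<rho>"
      using rs by (auto simp: rs'_def)
    hence "map f (transpose rs') \<in> \<rho>"
      using \<rho> by (auto simp: kf)
    also have "map f (transpose rs') = map (\<lambda>i. map f (transpose rs) ! h i) [0..<l]"
      using map_transpose_uniform[OF len' ne(2), of f] map_transpose_uniform[OF len ne(1), of f]
      by (simp add: rs'_def h o_def)
    finally show ?thesis
      using tup by simp
  qed
  thus ?thesis
    by (auto simp: kf)
qed

section \<open>Relations derived from a clausal relation\<close>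

lemma clausal_relation_iff:
  "z \<in> clausal_relation D a b \<longleftrightarrow>
     z \<in> tuples D (length a + length b) \<and>
     ((\<exists>i<length a. z ! i \<ge> a ! i) \<or> (\<exists>j<length b. z ! (length a + j) \<le> b ! j))"
  (is "?L \<longleftrightarrow> ?R")
proof
  assume ?L
  then obtain x y where z: "z = x @ y" and x: "x \<in> tuples D (length a)"
    and y: "y \<in> tuples D (length b)"
    and c: "(\<exists>i<length a. x ! i \<ge> a ! i) \<or> (\<exists>j<length b. y ! j \<le> b ! j)"
    by (auto simp: clausal_relation_def)
  have "z \<in> tuples D (length a + length b)"
    using x y by (auto simp: z tuples_def)
  thus ?R
    using c x by (auto simp: z tuples_def nth_append)
next
  assume R: ?R
  define x where "x = take (length a) z"
  define y where "y = drop (length a) z"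
  have "z = x @ y" "x \<in> tuples D (length a)" "y \<in> tuples D (length b)"
    using R by (auto simp: x_def y_def tuples_def dest: in_set_takeD in_set_dropD)
  moreover have "x ! i = z ! i" if "i < length a" for i
    using that by (simp add: x_def)
  moreover have "y ! j = z ! (length a + j)" if "j < length b" for j
    using R by (simp add: y_def tuples_def)
  ultimately show ?L
    using R unfolding clausal_relation_def by (smt (verit) mem_Collect_eq)
qed

lemma tuples_1_iff: "z \<in> tuples D 1 \<longleftrightarrow> (\<exists>x\<in>D. z = [x])"
  by (auto simp: tuples_def length_Suc_conv)

lemma tuples_2_iff: "z \<in> tuples D 2 \<longleftrightarrow> (\<exists>x\<in>D. \<exists>y\<in>D. z = [x, y])"
  by (auto simp: tuples_def length_Suc_conv numeral_2_eq_2)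

lemma binary_clause_iff:
  "z \<in> clausal_relation D [\<alpha>] [\<beta>] \<longleftrightarrow> (\<exists>x\<in>D. \<exists>y\<in>D. z = [x, y] \<and> (x \<ge> \<alpha> \<or> y \<le> \<beta>))"
  using tuples_2_iff[of z D] by (auto simp: clausal_relation_iff numeral_2_eq_2)

text \<open>
  After all \<open>x\<close>-variables have been equated, the weakest of the conditions \<open>x \<ge> a\<^sub>i\<close>, the one
  for the least \<open>a\<^sub>i\<close>, absorbs the others; dually for the \<open>y\<close>-variables.
\<close>

lemma preserves_binary_clause:
  assumes g: "g \<in> operations D" and \<rho>: "preserves g (clausal_relation D a b)"
    and ne: "a \<noteq> []" "b \<noteq> []"
  shows "preserves g (clausal_relation D [Min (set a)] [Max (set b)])"
proof -
  define h where "h i = (if i < length a then 0 else 1 :: nat)" for i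
  have min: "(\<exists>i<length a. a ! i \<le> x) \<longleftrightarrow> Min (set a) \<le> x" for x
    using ne by (simp add: Min_le_iff) (metis in_set_conv_nth)
  have max: "(\<exists>j<length b. y \<le> b ! j) \<longleftrightarrow> y \<le> Max (set b)" for y
    using ne by (simp add: Max_ge_iff) (metis in_set_conv_nth)
  have "map (\<lambda>i. [x, y] ! h i) [0..<length a + length b] \<in> clausal_relation D a b \<longleftrightarrow>
          Min (set a) \<le> x \<or> y \<le> Max (set b)" (is "?z \<in> _ \<longleftrightarrow> _")
    if "x \<in> D" "y \<in> D" for x y
  proof -
    have "?z \<in> tuples D (length a + length b)"
      using that by (auto simp: tuples_def h_def)
    thus ?thesis
      unfolding clausal_relation_iff min[symmetric] max[symmetric] by (auto simp: h_def)
  qed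
  hence "clausal_relation D [Min (set a)] [Max (set b)] =
      {z \<in> tuples D 2. map (\<lambda>i. z ! h i) [0..<length a + length b] \<in> clausal_relation D a b}"
    by (auto simp: binary_clause_iff tuples_2_iff)
  thus ?thesis
    using preserves_minor[OF g \<rho>, of _ h 2] by (simp add: h_def)
qed

lemma preserves_two_block_relation:
  fixes \<alpha> \<beta> :: nat
  assumes g: "g \<in> operations {0..<n}"
    and \<rho>: "preserves g (clausal_relation {0..<n} [\<alpha>] [\<beta>])"
    and ab: "\<alpha> \<le> \<beta> + 1" "\<beta> < n - 1"
  shows "preserves g (tuples {0..\<beta>} 2 \<union> tuples {\<alpha>..n - 1} 2)"
proof -
  let ?C = "clausal_relation {0..<n} [\<alpha>] [\<beta>]"
  \<comment> \<open>The coordinate map \<open>\<lambda>i. 1 - i\<close> exchanges the two variables.\<close>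
  let ?C' = "{z \<in> tuples {0..<n} 2. map (\<lambda>i. z ! (1 - i)) [0..<2] \<in> ?C}"
  have D: "{0..<n} = {0..n - 1}"
    using ab by auto
  have "?C \<inter> ?C' = tuples {0..\<beta>} 2 \<union> tuples {\<alpha>..n - 1} 2"
    unfolding D using ab by (auto simp: binary_clause_iff tuples_2_iff upt_conv_Cons)
  moreover have "preserves g (?C \<inter> ?C')"
    using g \<rho> by (intro preserves_Int preserves_minor) auto
  ultimately show ?thesis
    by simp
qed

lemma preserves_gap_relation:
  fixes \<alpha> \<beta> :: nat
  assumes g: "g \<in> operations {0..<n}"
    and \<rho>: "preserves g (clausal_relation {0..<n} [\<alpha>] [\<beta>])"
    and b: "\<beta> < n - 1"
  shows "preserves g (tuples ({0..\<beta>} \<union> {\<alpha>..n - 1}) 1)"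
proof -
  have D: "{0..<n} = {0..n - 1}"
    using b by auto
  have "preserves g {z \<in> tuples {0..<n} 1. map (\<lambda>i. z ! 0) [0..<2]
          \<in> clausal_relation {0..<n} [\<alpha>] [\<beta>]}" (is "preserves g ?\<sigma>")
    using g \<rho> by (intro preserves_minor) auto
  also have "?\<sigma> = tuples ({0..\<beta>} \<union> {\<alpha>..n - 1}) 1"
    unfolding D using b by (auto simp del: One_nat_def simp: binary_clause_iff tuples_1_iff upt_conv_Cons)
  finally show ?thesis .
qed

lemma clausal_relation_eq_tuples:
  fixes a b :: "nat list"
  assumes "0 \<in> set a \<or> n - 1 \<in> set b"
  shows "clausal_relation {0..<n} a b = tuples {0..<n} (length a + length b)"
proof -
  have "(\<exists>i<length a. z ! i \<ge> a ! i) \<or> (\<exists>j<length b. z ! (length a + j) \<le> b ! j)"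
    if z: "z \<in> tuples {0..<n} (length a + length b)" for z
    using assms
  proof
    assume "0 \<in> set a"
    thus ?thesis
      by (metis in_set_conv_nth le0)
  next
    assume "n - 1 \<in> set b"
    then obtain j where j: "j < length b" "b ! j = n - 1"
      by (auto simp: in_set_conv_nth)
    have "z ! (length a + j) \<in> set z"
      using z j by (simp add: tuples_def)
    moreover have "x \<le> n - 1" if "x \<in> set z" for x
      using z that by (fastforce simp: tuples_def)
    ultimately have "z ! (length a + j) \<le> b ! j"
      by (simp add: j)
    thus ?thesis
      using j by blast
  qed
  thus ?thesis
    by (auto simp: clausal_relation_iff)
qed

section \<open>The completeness criterion\<close>

theorem corollary7p3:
  fixes n :: nat
    and Q :: "nat list set set"
    and F :: "(nat \<times> (nat list \<Rightarrow> nat)) set"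
  assumes "n \<ge> 3"
    and "Q \<subseteq> clausal_relations {0..<n}"
    and "F = Pol {0..<n} Q"
    and "\<And>b. b < n - 1 \<Longrightarrow> \<exists>f\<in>F. \<not> preserves f (theta n b)"
    and "\<And>a b. 0 < a \<Longrightarrow> a \<le> b \<Longrightarrow> b < n - 1 \<Longrightarrow>
           \<exists>f\<in>F. \<not> preserves f (tuples {0..b} 2 \<union> tuples {a..n - 1} 2)"
    and "\<And>b k. b \<le> n - 3 \<Longrightarrow> 2 \<le> k \<Longrightarrow> k \<le> n - 1 - b \<Longrightarrow>
           \<exists>f\<in>F. \<not> preserves f (tuples ({0..b} \<union> {b + k..n - 1}) 1)"
  shows "F = operations {0..<n}"
proof -
  have full: "\<exists>m. \<rho> = tuples {0..<n} m" if mem: "\<rho> \<in> Q" for \<rho>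
  proof -
    obtain a b where \<rho>: "\<rho> = clausal_relation {0..<n} a b"
      and ne: "a \<noteq> []" "b \<noteq> []" and D: "set a \<subseteq> {0..<n}" "set b \<subseteq> {0..<n}"
      using mem assms(2) by (fastforce simp: clausal_relations_def tuples_def)
    have "0 \<in> set a \<or> n - 1 \<in> set b"
    proof (rule ccontr)
      assume nontrivial: "\<not> (0 \<in> set a \<or> n - 1 \<in> set b)"
      define \<alpha> where "\<alpha> = Min (set a)"
      define \<beta> where "\<beta> = Max (set b)"
      have "\<alpha> \<in> set a" "\<beta> \<in> set b"
        using ne by (simp_all add: \<alpha>_def \<beta>_def)
      hence "\<alpha> \<noteq> 0" "\<alpha> < n" "\<beta> \<noteq> n - 1" "\<beta> < n"
        using nontrivial D by (metis, fastforce, metis, fastforce)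
      hence \<alpha>: "0 < \<alpha>" "\<alpha> \<le> n - 1" and \<beta>: "\<beta> < n - 1"
        by auto
      have op: "g \<in> operations {0..<n}" if "g \<in> F" for g
        using that by (simp add: assms(3) Pol_def)
      have clause: "preserves g (clausal_relation {0..<n} [\<alpha>] [\<beta>])" if "g \<in> F" for g
        using preserves_binary_clause[OF op[OF that] _ ne] that mem
        by (auto simp: assms(3) Pol_def \<rho> \<alpha>_def \<beta>_def)
      consider "\<alpha> \<le> \<beta>" | "\<alpha> = \<beta> + 1" | "\<alpha> \<ge> \<beta> + 2"
        by linarith
      thus False
      proof cases
        case 1
        thus False
          using assms(5)[OF \<alpha>(1) _ \<beta>] preserves_two_block_relation[OF op clause _ \<beta>] by auto
      next
        case 2
        hence "theta n \<beta> = tuples {0..\<beta>} 2 \<union> tuples {\<alpha>..n - 1} 2"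
          by (simp add: theta_def partition_relation_def)
        thus False
          using 2 assms(4)[OF \<beta>] preserves_two_block_relation[OF op clause _ \<beta>] by auto
      next
        case 3
        hence "\<beta> \<le> n - 3" "2 \<le> \<alpha> - \<beta>" "\<alpha> - \<beta> \<le> n - 1 - \<beta>" "\<beta> + (\<alpha> - \<beta>) = \<alpha>"
          using \<alpha> by auto
        thus False
          using assms(6)[of \<beta> "\<alpha> - \<beta>"] preserves_gap_relation[OF op clause \<beta>] by auto
      qed
    qed
    thus ?thesis
      using clausal_relation_eq_tuples \<rho> by blast
  qed
  have "preserves g \<rho>" if "g \<in> operations {0..<n}" "\<rho> \<in> Q" for g \<rho>
    using full[OF that(2)] operations_preserve_tuples[OF that(1)] by blast
  thus ?thesis
    by (auto simp: assms(3) Pol_def)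
qed

end
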